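(* Let $\gamma:\mathbb{S}^1\to\mathbb{R}^2$ be a smooth, closed, rotating solution of the length-constrained curve diffusion flow with circumference length $L_0$. Then $\gamma(\mathbb{S}^1)$ is a standard round circle of circumference $L_0$.
   Context: For a closed regular plane curve $\gamma$, $s$ is arc length, $\nu$ is the unit normal obtained by rotating the unit tangent $\gamma_s$ by $+\pi/2$, $k$ is the scalar curvature ($\gamma_{ss}=k\nu$), subscripts $s$ denote arc length derivatives, and $\omega=\frac1{2\pi}\int k\,ds$ is the winding number. The length-constrained curve diffusion flow is the flow of closed plane curves with normal velocity $$\partial_t^\perp\gamma:=\langle\partial_t\gamma,\nu\rangle=h-k_{ss},\qquad h=-\frac{\int_\gamma k_s^2\,ds}{2\pi\omega}$$ (the definition of $h$ presupposes $\omega\neq0$). Length is constant along the flow. A closed curve $\gamma$ is a rotating solution if its image evolves under the flow purely by rotation (about the origin), i.e. if at each time $h(t)-k_{ss}=2S(t)\langle\gamma,\gamma_s\rangle$ along $\gamma$ for some real-valued function $S$ of time only.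
   Formalization: The circumference is counted with multiplicity: the image is a round circle of circumference L_0/|ω|, where ω is the winding number. It equals L_0 when |ω| = 1; a multiply covered circle is a stationary solution for which the literal claim fails. *)

theory Defs
  imports "HOL-Analysis.Analysis"
begin

definition smooth :: "(real \<Rightarrow> 'a::real_normed_vector) \<Rightarrow> bool" where
  "smooth f \<longleftrightarrow> (\<exists>D :: nat \<Rightarrow> real \<Rightarrow> 'a. D 0 = f \<and>
     (\<forall>n u. (D n has_vector_derivative D (Suc n) u) (at u)))"

text \<open>Maps on the circle are represented by maps on the real line of period \<open>2 * pi\<close>;
  the image of the circle is then the range of the map.\<close>

definition smooth_closed_curve :: "(real \<Rightarrow> real^2) \<Rightarrow> bool" where
  "smooth_closed_curve \<gamma> \<longleftrightarrow> smooth \<gamma> \<and> (\<forall>u. \<gamma> (u + 2 * pi) = \<gamma> u)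
     \<and> (\<forall>u. vector_derivative \<gamma> (at u) \<noteq> 0)"

definition speed :: "(real \<Rightarrow> real^2) \<Rightarrow> real \<Rightarrow> real" where
  "speed \<gamma> u = norm (vector_derivative \<gamma> (at u))"

definition arc_deriv ::
  "(real \<Rightarrow> real^2) \<Rightarrow> (real \<Rightarrow> 'a::real_normed_vector) \<Rightarrow> real \<Rightarrow> 'a" where
  "arc_deriv \<gamma> f u = vector_derivative f (at u) /\<^sub>R speed \<gamma> u"

definition arc_integral :: "(real \<Rightarrow> real^2) \<Rightarrow> (real \<Rightarrow> real) \<Rightarrow> real" where
  "arc_integral \<gamma> f = integral {0..2 * pi} (\<lambda>u. f u * speed \<gamma> u)"

definition curve_length :: "(real \<Rightarrow> real^2) \<Rightarrow> real" where
  "curve_length \<gamma> = arc_integral \<gamma> (\<lambda>_. 1)"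

definition tangent :: "(real \<Rightarrow> real^2) \<Rightarrow> real \<Rightarrow> real^2" where
  "tangent \<gamma> = arc_deriv \<gamma> \<gamma>"

definition rot90 :: "real^2 \<Rightarrow> real^2" where
  "rot90 v = vector [- (v $ 2), v $ 1]"

definition normal :: "(real \<Rightarrow> real^2) \<Rightarrow> real \<Rightarrow> real^2" where
  "normal \<gamma> u = rot90 (tangent \<gamma> u)"

text \<open>For regular smooth curves this is the scalar determined by \<open>\<gamma>\<^sub>s\<^sub>s = k \<nu>\<close>;
  see \<open>curvature_eq\<close> below.\<close>

definition curvature :: "(real \<Rightarrow> real^2) \<Rightarrow> real \<Rightarrow> real" where
  "curvature \<gamma> u = arc_deriv \<gamma> (tangent \<gamma>) u \<bullet> normal \<gamma> u"

text \<open>The winding number of the unit tangent, not of the curve around a point.\<close>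

definition turning_number :: "(real \<Rightarrow> real^2) \<Rightarrow> real" where
  "turning_number \<gamma> = arc_integral \<gamma> (curvature \<gamma>) / (2 * pi)"

definition lc_force :: "(real \<Rightarrow> real^2) \<Rightarrow> real" where
  "lc_force \<gamma> = - (arc_integral \<gamma> (\<lambda>u. (arc_deriv \<gamma> (curvature \<gamma>) u)\<^sup>2)
                    / (2 * pi * turning_number \<gamma>))"

definition lc_speed :: "(real \<Rightarrow> real^2) \<Rightarrow> real \<Rightarrow> real" where
  "lc_speed \<gamma> u = lc_force \<gamma> - arc_deriv \<gamma> (arc_deriv \<gamma> (curvature \<gamma>)) u"

text \<open>Time derivatives are taken within the time interval \<open>I\<close>, hence one-sided at its end points;
  \<open>I\<close> is required to be non-degenerate so that they are well defined. Nonzero turning number is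
  what the definition of \<open>lc_force\<close> presupposes.\<close>

definition lc_curve_diffusion_flow :: "real set \<Rightarrow> (real \<Rightarrow> real \<Rightarrow> real^2) \<Rightarrow> bool" where
  "lc_curve_diffusion_flow I \<gamma> \<longleftrightarrow>
     is_interval I \<and> interior I \<noteq> {} \<and>
     (\<forall>t\<in>I. smooth_closed_curve (\<gamma> t) \<and> turning_number (\<gamma> t) \<noteq> 0 \<and>
        (\<forall>u. \<exists>V. ((\<lambda>\<tau>. \<gamma> \<tau> u) has_vector_derivative V) (at t within I) \<and>
                 V \<bullet> normal (\<gamma> t) u = lc_speed (\<gamma> t) u))"

definition rotating_solution :: "real set \<Rightarrow> (real \<Rightarrow> real \<Rightarrow> real^2) \<Rightarrow> bool" where
  "rotating_solution I \<gamma> \<longleftrightarrow> lc_curve_diffusion_flow I \<gamma> \<and>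
     (\<exists>S :: real \<Rightarrow> real. \<forall>t\<in>I. \<forall>u.
        lc_speed (\<gamma> t) u = 2 * S t * (\<gamma> t u \<bullet> tangent (\<gamma> t) u))"

lemma curvature_eq:
  assumes "smooth_closed_curve \<gamma>"
  shows "arc_deriv \<gamma> (tangent \<gamma>) u = curvature \<gamma> u *\<^sub>R normal \<gamma> u"
proof -
  obtain D where D0: "D 0 = \<gamma>"
    and D: "\<And>n u. (D n has_vector_derivative D (Suc n) u) (at u)"
    using assms unfolding smooth_closed_curve_def smooth_def by blast
  have D1: "vector_derivative \<gamma> (at v) = D 1 v" for v
    using D[of 0 v] D0 by (simp add: vector_derivative_at)
  have nz: "D 1 v \<noteq> 0" for v
    using assms D1 unfolding smooth_closed_curve_def by metis
  have tan: "tangent \<gamma> = (\<lambda>v. D 1 v /\<^sub>R norm (D 1 v))"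
    by (auto simp: tangent_def arc_deriv_def speed_def D1)
  have "D 1 differentiable (at u)"
    using D[of 1 u] by (auto simp: has_vector_derivative_def differentiable_def)
  moreover have "(\<lambda>v. norm (D 1 v)) differentiable (at u)"
    using differentiable_compose[of norm "D 1" u UNIV] calculation nz
      differentiable_norm_at by blast
  ultimately have "tangent \<gamma> differentiable (at u)"
    unfolding tan using nz by (intro differentiable_scaleR differentiable_inverse) auto
  then have T: "(tangent \<gamma> has_vector_derivative vector_derivative (tangent \<gamma>) (at u)) (at u)"
    by (simp add: vector_derivative_works)
  have one: "tangent \<gamma> v \<bullet> tangent \<gamma> v = 1" for v
    using nz[of v] by (simp add: tan dot_square_norm power2_eq_square)
  let ?T = "tangent \<gamma> u" and ?T' = "vector_derivative (tangent \<gamma>) (at u)"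
  have "((\<lambda>v. tangent \<gamma> v \<bullet> tangent \<gamma> v) has_vector_derivative (?T \<bullet> ?T' + ?T' \<bullet> ?T)) (at u)"
    using bounded_bilinear.has_vector_derivative[OF bounded_bilinear_inner T T] .
  then have "?T \<bullet> ?T' + ?T' \<bullet> ?T = 0"
    unfolding one using has_vector_derivative_const vector_derivative_unique_at by blast
  then have orth: "?T \<bullet> ?T' = 0" by (simp add: inner_commute)
  have *: "b = (b \<bullet> rot90 a) *\<^sub>R rot90 a" if "a \<bullet> a = 1" "a \<bullet> b = 0" for a b :: "real^2"
  proof -
    have "a$1 * a$1 + a$2 * a$2 = 1" "a$1 * b$1 + a$2 * b$2 = 0"
      using that by (auto simp: inner_vec_def sum_2)
    then have "b$1 = (b$2 * a$1 - b$1 * a$2) * - (a$2)" "b$2 = (b$2 * a$1 - b$1 * a$2) * a$1"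
      by algebra+
    then show ?thesis
      by (simp add: vec_eq_iff forall_2 rot90_def inner_vec_def sum_2)
  qed
  have "?T \<bullet> arc_deriv \<gamma> (tangent \<gamma>) u = 0"
    using orth by (simp add: arc_deriv_def)
  from *[OF one this] show ?thesis
    by (simp add: curvature_def normal_def)
qed

end

theory Submission
  imports Defs
begin

text \<open>Both \<open>k\<^sub>s\<^sub>s\<close> and \<open>2 S \<langle>\<gamma>, \<gamma>\<^sub>s\<rangle> = (S \<bar>\<gamma>\<bar>\<^sup>2)\<^sub>s\<close> are arc length derivatives of
  functions on the circle, so integrating the rotation equation over the curve leaves \<open>h L = 0\<close>.
  Then \<open>\<integral> k\<^sub>s\<^sup>2 ds = 0\<close>, the curvature is a constant \<open>\<kappa>\<close>, non-zero because the turning number is,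
  and \<open>\<gamma> + \<nu> / \<kappa>\<close> is a fixed centre. The whole circle is covered because over one
  period the tangent angle changes by \<open>\<kappa> L\<close>, which is non-zero and, by periodicity of
  the tangent, a multiple of \<open>2 * pi\<close>.\<close>

section \<open>Periodicity of arc length quantities\<close>

text \<open>Shifting by \<open>p\<close>, and back by \<open>- p\<close>, shows that
  \<open>f\<close> has the same derivatives at \<open>u\<close> and at \<open>u + p\<close>. The
  choice operator behind \<open>vector_derivative\<close> thus picks the same value at both points,
  whether \<open>f\<close> is differentiable there or not.\<close>

lemma vector_derivative_periodic:
  fixes f :: "real \<Rightarrow> 'a::real_normed_vector"
  assumes "\<And>u. f (u + p) = f u"
  shows "vector_derivative f (at (u + p)) = vector_derivative f (at u)"
proof -
  have shift: "((\<lambda>x. h (x + c)) has_vector_derivative d) (at v)"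
    if "(h has_vector_derivative d) (at (v + c))" for h :: "real \<Rightarrow> 'a" and c d v
  proof -
    have "((h \<circ> (\<lambda>x. x + c)) has_vector_derivative (1 *\<^sub>R d)) (at v)"
      by (rule vector_diff_chain_at) (use that in \<open>auto intro!: derivative_eq_intros\<close>)
    then show ?thesis by (simp add: o_def)
  qed
  have "(f has_vector_derivative d) (at (u + p)) \<longleftrightarrow> (f has_vector_derivative d) (at u)" for d
    using shift[of f d u p] shift[of "\<lambda>x. f x" d "u + p" "- p"] assms
    by (auto simp: fun_eq_iff) (metis add.commute add_uminus_conv_diff diff_add_cancel ext)
  then show ?thesis by (simp add: vector_derivative_def)
qed

lemma speed_periodic:
  assumes "smooth_closed_curve \<gamma>"
  shows "speed \<gamma> (u + 2 * pi) = speed \<gamma> u"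
  using assms vector_derivative_periodic[of \<gamma> "2 * pi" u]
  by (simp add: speed_def smooth_closed_curve_def)

lemma arc_deriv_periodic:
  assumes "smooth_closed_curve \<gamma>" "\<And>u. f (u + 2 * pi) = f u"
  shows "arc_deriv \<gamma> f (u + 2 * pi) = arc_deriv \<gamma> f u"
  using vector_derivative_periodic[of f "2 * pi" u] speed_periodic[OF assms(1)] assms(2)
  by (simp add: arc_deriv_def)

lemma tangent_periodic:
  assumes "smooth_closed_curve \<gamma>"
  shows "tangent \<gamma> (u + 2 * pi) = tangent \<gamma> u"
  unfolding tangent_def using assms
  by (intro arc_deriv_periodic) (auto simp: smooth_closed_curve_def)

lemma curvature_periodic:
  assumes "smooth_closed_curve \<gamma>"
  shows "curvature \<gamma> (u + 2 * pi) = curvature \<gamma> u"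
  by (simp add: curvature_def normal_def tangent_periodic[OF assms]
      arc_deriv_periodic[where f = "tangent \<gamma>", OF assms tangent_periodic[OF assms]])

section \<open>The unit tangent and the quarter turn\<close>

lemma speed_pos: "smooth_closed_curve \<gamma> \<Longrightarrow> 0 < speed \<gamma> u"
  by (simp add: speed_def smooth_closed_curve_def)

lemma norm_tangent: "smooth_closed_curve \<gamma> \<Longrightarrow> norm (tangent \<gamma> u) = 1"
  using speed_pos[of \<gamma> u] by (simp add: tangent_def arc_deriv_def speed_def)

text \<open>This is the chain rule d/du = |\<gamma>'| d/ds. Differentiability makes the value of
  \<open>vector_derivative\<close> inside \<open>arc_deriv\<close> a genuine derivative.\<close>

lemma has_arc_deriv:
  assumes "smooth_closed_curve \<gamma>" "f differentiable (at u)"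
  shows "(f has_vector_derivative speed \<gamma> u *\<^sub>R arc_deriv \<gamma> f u) (at u)"
  using assms(2) speed_pos[OF assms(1), of u]
  by (simp add: arc_deriv_def vector_derivative_works[symmetric])

lemma bounded_linear_rot90: "bounded_linear rot90"
  by (rule linear_conv_bounded_linear[THEN iffD1], rule linearI)
    (simp_all add: rot90_def vec_eq_iff forall_2)

lemma rot90_scaleR: "rot90 (c *\<^sub>R v) = c *\<^sub>R rot90 v"
  by (simp add: rot90_def vec_eq_iff forall_2)

lemma rot90_rot90: "rot90 (rot90 v) = - v"
  by (simp add: rot90_def vec_eq_iff forall_2)

lemma norm_rot90: "norm (rot90 v) = norm v"
  by (simp add: norm_vec_def L2_set_def rot90_def sum_2 add.commute)

lemma inner_rot90_self: "v \<bullet> rot90 v = 0"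
  by (simp add: rot90_def inner_vec_def sum_2)

section \<open>Frenet equations and differentiability of the curvature\<close>

text \<open>Smoothness is given for \<gamma> in the parameter \<open>u\<close>, so the arc length
  quantities are written through inner products of the derivatives \<open>D n\<close> and powers of
  |\<gamma>'| > 0. Each of these can be differentiated explicitly.\<close>

lemma has_derivs:
  assumes "smooth_closed_curve \<gamma>"
  shows curve_has_arc_deriv:
      "(\<gamma> has_vector_derivative speed \<gamma> u *\<^sub>R tangent \<gamma> u) (at u)"
    and tangent_has_arc_deriv:
      "(tangent \<gamma> has_vector_derivative (speed \<gamma> u * curvature \<gamma> u) *\<^sub>R normal \<gamma> u) (at u)"
    and curvature_has_arc_deriv: "(curvature \<gamma> has_vector_derivative
        speed \<gamma> u *\<^sub>R arc_deriv \<gamma> (curvature \<gamma>) u) (at u)"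
    and curvature_s_has_arc_deriv: "(arc_deriv \<gamma> (curvature \<gamma>) has_vector_derivative
        speed \<gamma> u *\<^sub>R arc_deriv \<gamma> (arc_deriv \<gamma> (curvature \<gamma>)) u) (at u)"
    and continuous_speed: "isCont (speed \<gamma>) u"
proof -
  obtain D where D0: "D 0 = \<gamma>"
    and D: "\<And>n u. (D n has_vector_derivative D (Suc n) u) (at u)"
    using assms unfolding smooth_closed_curve_def smooth_def by blast
  have D1: "vector_derivative \<gamma> (at v) = D 1 v" for v
    using D[of 0 v] D0 by (simp add: vector_derivative_at)
  have nz: "D 1 v \<noteq> 0" for v
    using assms D1 unfolding smooth_closed_curve_def by metis
  have ip: "((\<lambda>v. D i v \<bullet> D j v) has_real_derivative
      (D i v \<bullet> D (Suc j) v + D (Suc i) v \<bullet> D j v)) (at v)" for i j v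
    using bounded_bilinear.has_vector_derivative[OF bounded_bilinear_inner D D]
    by (simp add: has_real_derivative_iff_has_vector_derivative)
  have R: "((\<lambda>v. rot90 (D i v)) has_vector_derivative rot90 (D (Suc i) v)) (at v)" for i v
    by (rule bounded_linear.has_vector_derivative[OF bounded_linear_rot90 D])
  have ir: "((\<lambda>v. D i v \<bullet> rot90 (D j v)) has_real_derivative
      (D i v \<bullet> rot90 (D (Suc j) v) + D (Suc i) v \<bullet> rot90 (D j v))) (at v)" for i j v
    using bounded_bilinear.has_vector_derivative[OF bounded_bilinear_inner D R]
    by (simp add: has_real_derivative_iff_has_vector_derivative)
  \<comment> \<open>\<open>g\<close> is the squared speed, \<open>p\<close> is half its derivative,
    \<open>q\<close> is the determinant of \<gamma>' and \<gamma>'', and \<open>q1\<close> is the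
    derivative of \<open>q\<close>: the other term of the product rule is \<gamma>'' paired with its
    own quarter turn, which is 0.\<close>
  define g p q q1 where "g = (\<lambda>v. D 1 v \<bullet> D 1 v)" and "p = (\<lambda>v. D 1 v \<bullet> D 2 v)"
    and "q = (\<lambda>v. D 2 v \<bullet> rot90 (D 1 v))" and "q1 = (\<lambda>v. D 3 v \<bullet> rot90 (D 1 v))"
  note defs = g_def p_def q_def q1_def
  have gpos: "0 < g v" for v using nz by (simp add: g_def)
  have speed: "speed \<gamma> = (\<lambda>v. sqrt (g v))"
    by (simp add: fun_eq_iff speed_def D1 g_def norm_eq_sqrt_inner)
  have g': "(g has_real_derivative 2 * p v) (at v)" for v
    using ip[of 1 1 v] by (simp add: defs inner_commute numeral_2_eq_2)
  have p': "p field_differentiable (at v)" for v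
    using ip[of 1 2 v] unfolding p_def field_differentiable_def by blast
  have q': "(q has_real_derivative q1 v) (at v)" for v
    using ir[of 2 1 v] by (simp add: defs inner_rot90_self numeral_2_eq_2 numeral_3_eq_3)
  have q1': "q1 field_differentiable (at v)" for v
    using ir[of 3 1 v] unfolding q1_def field_differentiable_def by blast
  have w': "((\<lambda>v. sqrt (g v)) has_real_derivative p v / sqrt (g v)) (at v)" for v
    using gpos[of v] by (auto intro!: derivative_eq_intros g' simp: field_simps)
  show "isCont (speed \<gamma>) u" unfolding speed by (rule DERIV_isCont[OF w'])
  have tan: "tangent \<gamma> = (\<lambda>v. inverse (sqrt (g v)) *\<^sub>R D 1 v)"
    by (simp add: fun_eq_iff tangent_def arc_deriv_def speed D1)
  have iw': "((\<lambda>v. inverse (sqrt (g v))) has_real_derivative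
      - (p v / sqrt (g v) * inverse ((sqrt (g v))\<^sup>2))) (at v)" for v
    using DERIV_inverse_fun[OF w', of v] gpos[of v] by (simp add: power2_eq_square)
  have T': "(tangent \<gamma> has_vector_derivative (inverse (sqrt (g v)) *\<^sub>R D 2 v
      + (- (p v / sqrt (g v) * inverse ((sqrt (g v))\<^sup>2))) *\<^sub>R D 1 v)) (at v)" for v
    unfolding tan using has_vector_derivative_scaleR[OF iw' D[of 1], of v]
    by (simp add: numeral_2_eq_2)
  show "(\<gamma> has_vector_derivative speed \<gamma> u *\<^sub>R tangent \<gamma> u) (at u)"
    unfolding tangent_def using D[of 0 u] D0
    by (intro has_arc_deriv assms) (auto simp: has_vector_derivative_def differentiable_def)
  have "(tangent \<gamma> has_vector_derivative speed \<gamma> u *\<^sub>R arc_deriv \<gamma> (tangent \<gamma>) u) (at u)"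
    using T'
    by (intro has_arc_deriv assms) (auto simp: has_vector_derivative_def differentiable_def)
  then show "(tangent \<gamma> has_vector_derivative (speed \<gamma> u * curvature \<gamma> u) *\<^sub>R normal \<gamma> u) (at u)"
    by (simp add: curvature_eq[OF assms])
  \<comment> \<open>The classical formula det(\<gamma>', \<gamma>'') / |\<gamma>'|^3: the part of
    the tangent's derivative along \<gamma>' is orthogonal to the normal and drops out.\<close>
  have k: "curvature \<gamma> = (\<lambda>v. q v / sqrt (g v) ^ 3)"
    by (simp add: fun_eq_iff curvature_def normal_def arc_deriv_def vector_derivative_at[OF T']
        speed fun_cong[OF tan] rot90_scaleR inner_diff_left inner_rot90_self q_def power3_eq_cube
        divide_inverse inverse_mult_distrib[symmetric]
        del: inverse_mult_distrib)
  have k': "(curvature \<gamma> has_real_derivative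
      sqrt (g v) * ((q1 v * g v - 3 * q v * p v) / g v ^ 3)) (at v)" for v
  proof -
    \<comment> \<open>With \<open>w\<close> as the speed and \<open>g v = w ^ 2\<close>, the
      quotient rule becomes a rational identity in \<open>w\<close>. Its right side keeps one factor
      \<open>w\<close> apart, to be cancelled by the arc length derivative.\<close>
    define w where "w = sqrt (g v)"
    have w: "w > 0" "g v = w ^ 2" using gpos[of v] by (auto simp: w_def)
    have "(q1 v * w ^ 3 - q v * (3 * (p v / w * w ^ 2))) / (w ^ 3 * w ^ 3)
        = w * ((q1 v * w ^ 2 - 3 * q v * p v) / (w ^ 2) ^ 3)"
      using w(1) by (simp add: divide_simps) algebra
    moreover have w3: "((\<lambda>v. sqrt (g v) ^ 3) has_real_derivative 3 * (p v / w * w ^ 2)) (at v)"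
      using DERIV_power[OF w'[of v], of 3] by (simp add: w_def)
    ultimately show ?thesis
      using DERIV_divide[OF q' w3] w(1) unfolding k w(2) w_def[symmetric] by simp
  qed
  \<comment> \<open>Division by the speed removes the square root, leaving a quotient of
    differentiable functions with positive denominator, so a further derivative exists.\<close>
  have ks: "arc_deriv \<gamma> (curvature \<gamma>) = (\<lambda>v. (q1 v * g v - 3 * q v * p v) / g v ^ 3)"
    using gpos vector_derivative_at[OF k'[unfolded has_real_derivative_iff_has_vector_derivative]]
    by (simp add: fun_eq_iff arc_deriv_def speed less_imp_neq[symmetric])
  show "(curvature \<gamma> has_vector_derivative
        speed \<gamma> u *\<^sub>R arc_deriv \<gamma> (curvature \<gamma>) u) (at u)"
    using k' by (simp add: ks speed has_real_derivative_iff_has_vector_derivative)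
  have "(\<lambda>v. (q1 v * g v - 3 * q v * p v) / g v ^ 3) field_differentiable (at u)"
    using g' q' p' q1' gpos[of u]
    by (intro derivative_intros) (auto simp: field_differentiable_def)
  then have "arc_deriv \<gamma> (curvature \<gamma>) differentiable (at u)"
    unfolding ks by (rule field_differentiable_imp_differentiable)
  then show "(arc_deriv \<gamma> (curvature \<gamma>) has_vector_derivative
        speed \<gamma> u *\<^sub>R arc_deriv \<gamma> (arc_deriv \<gamma> (curvature \<gamma>)) u) (at u)"
    by (rule has_arc_deriv[OF assms])
qed

section \<open>Length of the curve\<close>

lemma curve_length_has_integral:
  assumes "smooth_closed_curve \<gamma>"
  shows "(speed \<gamma> has_integral curve_length \<gamma>) {0..2 * pi}"
proof -
  have "continuous_on {0..2 * pi} (speed \<gamma>)"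
    by (intro continuous_at_imp_continuous_on ballI continuous_speed assms)
  then show ?thesis
    using integrable_continuous_real integrable_integral
    by (fastforce simp: curve_length_def arc_integral_def)
qed

lemma curve_length_pos:
  assumes "smooth_closed_curve \<gamma>"
  shows "0 < curve_length \<gamma>"
proof -
  have cont: "continuous_on {0..2 * pi} (speed \<gamma>)"
    by (intro continuous_at_imp_continuous_on ballI continuous_speed assms)
  have int: "(speed \<gamma> has_integral curve_length \<gamma>) (cbox 0 (2 * pi))"
    using curve_length_has_integral[OF assms] by simp
  have "0 \<le> curve_length \<gamma>"
    by (rule has_integral_nonneg[OF int]) (use speed_pos[OF assms] in \<open>auto simp: less_imp_le\<close>)
  moreover have "curve_length \<gamma> \<noteq> 0"
  proof
    assume "curve_length \<gamma> = 0"
    \<comment> \<open>A continuous nonnegative function with integral 0 vanishes at every point of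
      the interval.\<close>
    then have "speed \<gamma> 0 = 0"
      using has_integral_0_cbox_imp_0[of 0 "2 * pi" "speed \<gamma>" 0] int cont speed_pos[OF assms]
      by (simp add: less_imp_le not_le)
    then show False using speed_pos[OF assms, of 0] by simp
  qed
  ultimately show ?thesis by simp
qed

section \<open>Vanishing force and constant curvature\<close>

lemma lc_force_rotator_eq_0:
  assumes \<gamma>: "smooth_closed_curve \<gamma>"
    and rot: "\<And>u. lc_speed \<gamma> u = 2 * S * (\<gamma> u \<bullet> tangent \<gamma> u)"
  shows "lc_force \<gamma> = 0"
proof -
  \<comment> \<open>A periodic arc length primitive of the force: its derivative in s is k_ss plus
    the rotation term, that is k_ss + (h - k_ss) = h. At a fixed time \<open>S\<close> is just a
    number.\<close>
  define F where "F u = arc_deriv \<gamma> (curvature \<gamma>) u + S * (\<gamma> u \<bullet> \<gamma> u)" for u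
  have "(F has_vector_derivative lc_force \<gamma> * speed \<gamma> u) (at u within {0..2 * pi})" for u
  proof -
    have "((\<lambda>v. \<gamma> v \<bullet> \<gamma> v) has_real_derivative 2 * speed \<gamma> u * (\<gamma> u \<bullet> tangent \<gamma> u)) (at u)"
      using bounded_bilinear.has_vector_derivative[OF bounded_bilinear_inner
          curve_has_arc_deriv[OF \<gamma>] curve_has_arc_deriv[OF \<gamma>], of u]
      by (simp add: has_real_derivative_iff_has_vector_derivative inner_commute mult.assoc)
    from DERIV_add[OF curvature_s_has_arc_deriv[OF \<gamma>, of u,
          folded has_real_derivative_iff_has_vector_derivative] DERIV_cmult[OF this, of S]]
    have "(F has_real_derivative
        (arc_deriv \<gamma> (arc_deriv \<gamma> (curvature \<gamma>)) u + lc_speed \<gamma> u) * speed \<gamma> u) (at u)"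
      by (simp add: F_def[abs_def] rot algebra_simps)
    then have "(F has_vector_derivative lc_force \<gamma> * speed \<gamma> u) (at u)"
      by (simp add: lc_speed_def has_real_derivative_iff_has_vector_derivative)
    then show ?thesis by (rule has_vector_derivative_at_within)
  qed
  then have "((\<lambda>u. lc_force \<gamma> * speed \<gamma> u) has_integral (F (2 * pi) - F 0)) {0..2 * pi}"
    by (intro fundamental_theorem_of_calculus) auto
  moreover have "F (2 * pi) = F 0"
  proof -
    have "\<gamma> (0 + 2 * pi) = \<gamma> 0" using \<gamma> by (simp only: smooth_closed_curve_def)
    then show ?thesis
      using arc_deriv_periodic[where f = "curvature \<gamma>",
          OF \<gamma> curvature_periodic[OF \<gamma>], of 0]
      by (simp add: F_def)
  qed
  moreover have int: "((\<lambda>u. lc_force \<gamma> * speed \<gamma> u) has_integral lc_force \<gamma> * curve_length \<gamma>) {0..2 * pi}"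
    by (intro has_integral_mult_right curve_length_has_integral \<gamma>)
  ultimately have "lc_force \<gamma> * curve_length \<gamma> = 0"
    using has_integral_unique[OF int] by simp
  then show ?thesis using curve_length_pos[OF \<gamma>] by simp
qed

lemma periodic_reduce:
  fixes u :: real
  assumes "0 < p"
  obtains v n where "v \<in> {0..<p}" "u = v + of_int n * p"
proof (rule that[of "u - of_int \<lfloor>u / p\<rfloor> * p" "\<lfloor>u / p\<rfloor>"])
  show "u - of_int \<lfloor>u / p\<rfloor> * p \<in> {0..<p}"
    using assms floor_divide_lower[OF assms, of u] floor_divide_upper[OF assms, of u]
    by (auto simp: algebra_simps)
qed simp

lemma curvature_constant:
  assumes \<gamma>: "smooth_closed_curve \<gamma>" and "turning_number \<gamma> \<noteq> 0" and "lc_force \<gamma> = 0"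
  obtains \<kappa> where "\<And>u. curvature \<gamma> u = \<kappa>"
proof -
  let ?ks = "arc_deriv \<gamma> (curvature \<gamma>)"
  let ?f = "\<lambda>u. (?ks u)\<^sup>2 * speed \<gamma> u"
  have cks: "isCont ?ks u" for u
    using has_vector_derivative_continuous[OF curvature_s_has_arc_deriv[OF \<gamma>]] .
  have cont: "continuous_on {0..2 * pi} ?f"
    by (intro continuous_at_imp_continuous_on ballI continuous_intros cks continuous_speed \<gamma>)
  \<comment> \<open>A zero quotient forces a zero numerator because the turning number is nonzero.
    With a zero denominator, \<open>lc_force\<close> would be 0 by the convention for division and
    would carry no information.\<close>
  have "integral {0..2 * pi} ?f = 0"
    using assms(2,3) by (simp add: lc_force_def arc_integral_def)
  then have int: "(?f has_integral 0) (cbox 0 (2 * pi))"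
    using integrable_integral[OF integrable_continuous_real[OF cont]] by simp
  have ks0: "?ks u = 0" if "u \<in> {0..2 * pi}" for u
  proof -
    have "?f u = 0"
      using has_integral_0_cbox_imp_0[of 0 "2 * pi" ?f u] int cont that speed_pos[OF \<gamma>]
      by (auto simp: less_imp_le not_le)
    then show ?thesis using speed_pos[OF \<gamma>, of u] by simp
  qed
  \<comment> \<open>The integral controls k_s on one period only; periodicity carries its vanishing
    to the whole line.\<close>
  interpret periodic_fun_simple ?ks "2 * pi"
    by unfold_locales (intro arc_deriv_periodic curvature_periodic \<gamma>)
  have "?ks u = 0" for u
  proof -
    obtain v n where "v \<in> {0..<2 * pi}" "u = v + of_int n * (2 * pi)"
      using periodic_reduce[of "2 * pi" u] by auto
    then show ?thesis using ks0[of v] by (simp add: plus_of_int)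
  qed
  then have "(curvature \<gamma> has_real_derivative 0) (at u)" for u
    using curvature_has_arc_deriv[OF \<gamma>, of u]
    by (simp add: has_real_derivative_iff_has_vector_derivative)
  then show ?thesis using DERIV_isconst_all[of "curvature \<gamma>" _ 0] that by blast
qed

section \<open>From constant curvature to a round circle\<close>

text \<open>The centre of curvature \<gamma> + \<nu>/\<kappa> does not move: \<nu>_s = -\<kappa>
  \<gamma>_s, since \<nu> is the quarter turn of \<gamma>_s and two quarter turns give -1, so its
  derivative is \<gamma>_s - \<gamma>_s = 0.\<close>

lemma constant_curvature_center:
  assumes \<gamma>: "smooth_closed_curve \<gamma>" and \<kappa>: "\<And>u. curvature \<gamma> u = \<kappa>" "\<kappa> \<noteq> 0"
  obtains c where "\<And>u. \<gamma> u = c - (1 / \<kappa>) *\<^sub>R normal \<gamma> u"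
proof -
  have "((\<lambda>v. \<gamma> v + (1 / \<kappa>) *\<^sub>R normal \<gamma> v) has_vector_derivative 0) (at u within UNIV)" for u
  proof -
    have "(normal \<gamma> has_vector_derivative - (speed \<gamma> u * \<kappa>) *\<^sub>R tangent \<gamma> u) (at u)"
      using bounded_linear.has_vector_derivative[OF bounded_linear_rot90
          tangent_has_arc_deriv[OF \<gamma>], of u] \<kappa>
      by (simp add: normal_def[abs_def] rot90_scaleR rot90_rot90)
    from has_vector_derivative_add[OF curve_has_arc_deriv[OF \<gamma>, of u]
        bounded_linear.has_vector_derivative[OF bounded_linear_scaleR_right this, of "1 / \<kappa>"]]
    show ?thesis using \<kappa> by simp
  qed
  then obtain c where "\<And>u. \<gamma> u + (1 / \<kappa>) *\<^sub>R normal \<gamma> u = c"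
    using has_vector_derivative_zero_constant[of UNIV "\<lambda>v. \<gamma> v + (1 / \<kappa>) *\<^sub>R normal \<gamma> v"]
    by (auto simp: has_vector_derivative_def)
  then show ?thesis using that by (metis add_diff_cancel_right')
qed

text \<open>The tangent turns at the constant rate \<kappa> per unit length, so its angle is an
  initial angle plus \<kappa> times the arc length. Turning the tangent back by the latter leaves a
  fixed unit vector, whose angle is the initial one; no general lifting of circle-valued maps
  enters.\<close>

lemma constant_curvature_tangent_angle:
  assumes \<gamma>: "smooth_closed_curve \<gamma>" and \<kappa>: "\<And>u. curvature \<gamma> u = \<kappa>"
  obtains \<theta> where "continuous_on {0..2 * pi} \<theta>" "\<theta> (2 * pi) = \<theta> 0 + \<kappa> * curve_length \<gamma>"
    "\<And>u. u \<in> {0..2 * pi} \<Longrightarrow> tangent \<gamma> u = vector [cos (\<theta> u), sin (\<theta> u)]"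
proof -
  let ?I = "{0..2 * pi}"
  define \<phi> where "\<phi> u = \<kappa> * integral {0..u} (speed \<gamma>)" for u
  define x where "x u = tangent \<gamma> u $ 1" for u
  define y where "y u = tangent \<gamma> u $ 2" for u
  have cont: "continuous_on ?I (speed \<gamma>)"
    by (intro continuous_at_imp_continuous_on ballI continuous_speed \<gamma>)
  have \<phi>': "(\<phi> has_real_derivative \<kappa> * speed \<gamma> u) (at u within ?I)" if "u \<in> ?I" for u
    unfolding \<phi>_def by (rule DERIV_cmult integral_has_real_derivative[OF cont that])+
  have comp: "((\<lambda>v. tangent \<gamma> v $ i) has_real_derivative
      speed \<gamma> u * \<kappa> * (normal \<gamma> u $ i)) (at u within ?I)" for i and u :: real
    using bounded_linear.has_vector_derivative[OF bounded_linear_vec_nth[of i]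
        tangent_has_arc_deriv[OF \<gamma>, of u]] \<kappa>
    by (auto simp: has_real_derivative_iff_has_vector_derivative
        intro: has_vector_derivative_at_within)
  have x': "(x has_real_derivative - (speed \<gamma> u * \<kappa> * y u)) (at u within ?I)" for u
    using comp[of 1 u] by (simp add: x_def[abs_def] y_def normal_def rot90_def)
  have y': "(y has_real_derivative speed \<gamma> u * \<kappa> * x u) (at u within ?I)" for u
    using comp[of 2 u] by (simp add: y_def[abs_def] x_def normal_def rot90_def)
  \<comment> \<open>\<open>A\<close> and, below, \<open>B\<close> are the coordinates of the tangent
    turned back by \<open>\<phi> u\<close>. Their derivatives cancel because tangent and
    \<open>\<phi>\<close> turn at the same rate.\<close>
  have "\<exists>A. \<forall>u\<in>?I. x u * cos (\<phi> u) + y u * sin (\<phi> u) = A"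
    by (rule has_field_derivative_zero_constant)
      (simp, (rule derivative_eq_intros x' y' \<phi>' refl | assumption)+, simp add: algebra_simps)
  then obtain A where A: "\<And>u. u \<in> ?I \<Longrightarrow> x u * cos (\<phi> u) + y u * sin (\<phi> u) = A" by blast
  have "\<exists>B. \<forall>u\<in>?I. y u * cos (\<phi> u) - x u * sin (\<phi> u) = B"
    by (rule has_field_derivative_zero_constant)
      (simp, (rule derivative_eq_intros x' y' \<phi>' refl | assumption)+, simp add: algebra_simps)
  then obtain B where B: "\<And>u. u \<in> ?I \<Longrightarrow> y u * cos (\<phi> u) - x u * sin (\<phi> u) = B" by blast
  have [simp]: "\<phi> 0 = 0" by (simp add: \<phi>_def)
  have "(x 0)\<^sup>2 + (y 0)\<^sup>2 = 1"
    using norm_tangent[OF \<gamma>, of 0]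
    by (simp add: x_def y_def norm_vec_def L2_set_def sum_2)
  then have "A\<^sup>2 + B\<^sup>2 = 1" using A[of 0] B[of 0] by simp
  then obtain a where a: "A = cos a" "B = sin a" using sincos_total_2pi by metis
  show thesis
  proof
    show "continuous_on ?I (\<lambda>u. a + \<phi> u)"
      by (intro continuous_intros DERIV_continuous_on[OF \<phi>'])
    show "a + \<phi> (2 * pi) = a + \<phi> 0 + \<kappa> * curve_length \<gamma>"
      by (simp add: \<phi>_def curve_length_def arc_integral_def)
    fix u assume u: "u \<in> ?I"
    \<comment> \<open>Turning forward again by \<open>\<phi> u\<close> recovers \<open>x\<close> and
      \<open>y\<close>, up to the factor sin^2 + cos^2 = 1.\<close>
    have "A * cos (\<phi> u) - B * sin (\<phi> u) = x u * ((sin (\<phi> u))\<^sup>2 + (cos (\<phi> u))\<^sup>2)"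
      "A * sin (\<phi> u) + B * cos (\<phi> u) = y u * ((sin (\<phi> u))\<^sup>2 + (cos (\<phi> u))\<^sup>2)"
      unfolding A[OF u, symmetric] B[OF u, symmetric]
      by (simp_all only: power2_eq_square algebra_simps)
    then have "x u = A * cos (\<phi> u) - B * sin (\<phi> u)" "y u = A * sin (\<phi> u) + B * cos (\<phi> u)"
      by simp_all
    then show "tangent \<gamma> u = vector [cos (a + \<phi> u), sin (a + \<phi> u)]"
      by (simp add: vec_eq_iff forall_2 x_def y_def a cos_add sin_add)
  qed
qed

text \<open>The tangent angle is continuous and changes over one period by a nonzero multiple of
  \<open>2 * pi\<close>, so by the intermediate value theorem it meets every angle modulo
  \<open>2 * pi\<close>. The normal, a quarter turn ahead, then meets every direction.\<close>

lemma constant_curvature_normal_surj: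
  assumes \<gamma>: "smooth_closed_curve \<gamma>" and \<kappa>: "\<And>u. curvature \<gamma> u = \<kappa>" "\<kappa> \<noteq> 0"
    and e: "norm e = 1"
  obtains u where "normal \<gamma> u = e"
proof -
  obtain \<theta> where cont: "continuous_on {0..2 * pi} \<theta>"
    and end_eq: "\<theta> (2 * pi) = \<theta> 0 + \<kappa> * curve_length \<gamma>"
    and \<theta>: "\<And>u. u \<in> {0..2 * pi} \<Longrightarrow> tangent \<gamma> u = vector [cos (\<theta> u), sin (\<theta> u)]"
    using constant_curvature_tangent_angle[OF \<gamma> \<kappa>(1)] by metis
  have "tangent \<gamma> (2 * pi) = tangent \<gamma> 0" using tangent_periodic[OF \<gamma>, of 0] by simp
  then have "cos (\<theta> (2 * pi)) = cos (\<theta> 0)" "sin (\<theta> (2 * pi)) = sin (\<theta> 0)"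
    using \<theta>[of 0] \<theta>[of "2 * pi"] by (simp_all add: vec_eq_iff forall_2)
  then obtain n :: int where n: "\<theta> (2 * pi) = \<theta> 0 + 2 * pi * n"
    using sin_cos_eq_iff by metis
  have "n \<noteq> 0" using n end_eq \<kappa>(2) curve_length_pos[OF \<gamma>] by auto
  \<comment> \<open>The sign of \<open>n\<close> depends on the orientation, so angles are measured
    from the smaller end value.\<close>
  define lo where "lo = min (\<theta> 0) (\<theta> (2 * pi))"
  \<comment> \<open>\<open>b\<close> is the angle of the unit vector whose quarter turn is
    \<open>e\<close>.\<close>
  have "(e $ 2)\<^sup>2 + (- (e $ 1))\<^sup>2 = 1"
    using e by (simp add: norm_vec_def L2_set_def sum_2 add.commute)
  then obtain b where b: "e $ 2 = cos b" "- (e $ 1) = sin b" using sincos_total_2pi by metis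
  \<comment> \<open>Modulo \<open>2 * pi\<close> the target angle \<open>b\<close> becomes
    \<open>lo + v\<close> with \<open>v\<close> less than a full turn. It lies between the end
    values of \<open>\<theta>\<close>, which differ by at least a full turn.\<close>
  obtain v m where v: "v \<in> {0..<2 * pi}" "b - lo = v + of_int m * (2 * pi)"
    using periodic_reduce[of "2 * pi" "b - lo"] by auto
  have "\<exists>u\<in>{0..2 * pi}. \<theta> u = lo + v"
  proof (cases "n > 0")
    case True
    then have "2 * pi * 1 \<le> 2 * pi * of_int n" by (intro mult_left_mono) auto
    then have "\<theta> 0 \<le> lo + v" "lo + v \<le> \<theta> (2 * pi)" 
      using v(1) n pi_gt_zero unfolding lo_def atLeastLessThan_iff by linarith+
    then show ?thesis using IVT'[of \<theta> 0 "lo + v" "2 * pi"] cont by auto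
  next
    case False
    then have "2 * pi * of_int n \<le> 2 * pi * (-1)" using \<open>n \<noteq> 0\<close> by (intro mult_left_mono) auto
    then have "\<theta> (2 * pi) \<le> lo + v" "lo + v \<le> \<theta> 0" 
      using v(1) n pi_gt_zero unfolding lo_def atLeastLessThan_iff by linarith+
    then show ?thesis using IVT2'[of \<theta> "2 * pi" "lo + v" 0] cont by auto
  qed
  then obtain u where u: "u \<in> {0..2 * pi}" "\<theta> u = lo + v" by blast
  have "\<theta> u = b + 2 * pi * of_int (- m)" using u v by (simp add: algebra_simps)
  then have "cos (\<theta> u) = cos b" "sin (\<theta> u) = sin b" using sin_cos_eq_iff by blast+
  then have "normal \<gamma> u = e"
    using \<theta>[OF u(1)] b by (simp add: normal_def rot90_def vec_eq_iff forall_2)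
  then show ?thesis using that by blast
qed

text \<open>A closed curve may run around its image several times, so the circumference
  \<open>L0\<close> is counted with multiplicity. On a circle of radius 1/|\<kappa>| this
  multiplicity is |\<kappa>| \<open>L0\<close> / (2 \<pi>), the absolute turning number.\<close>

theorem proposition1p5:
  fixes \<gamma> :: "real \<Rightarrow> real \<Rightarrow> real^2" and I :: "real set" and t L0 :: real
  assumes "rotating_solution I \<gamma>"
    and "t \<in> I"
    and "curve_length (\<gamma> t) = L0"
  shows "\<exists>c r. 0 < r \<and> range (\<gamma> t) = sphere c r \<and> \<bar>turning_number (\<gamma> t)\<bar> * (2 * pi * r) = L0"
proof -
  have \<gamma>: "smooth_closed_curve (\<gamma> t)" and tn: "turning_number (\<gamma> t) \<noteq> 0"
    using assms(1,2) by (auto simp: rotating_solution_def lc_curve_diffusion_flow_def)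
  obtain S where S: "\<And>u. lc_speed (\<gamma> t) u = 2 * S t * (\<gamma> t u \<bullet> tangent (\<gamma> t) u)"
    using assms(1,2) by (auto simp: rotating_solution_def)
  obtain \<kappa> where \<kappa>: "\<And>u. curvature (\<gamma> t) u = \<kappa>"
    using curvature_constant[OF \<gamma> tn lc_force_rotator_eq_0[OF \<gamma> S]] by blast
  have tn_eq: "turning_number (\<gamma> t) = \<kappa> * curve_length (\<gamma> t) / (2 * pi)"
    by (simp add: turning_number_def curve_length_def arc_integral_def \<kappa>)
  with tn have \<kappa>0: "\<kappa> \<noteq> 0" by auto
  obtain c where c: "\<And>u. \<gamma> t u = c - (1 / \<kappa>) *\<^sub>R normal (\<gamma> t) u"
    using constant_curvature_center[OF \<gamma> \<kappa> \<kappa>0] by blast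
  have "range (\<gamma> t) = sphere c (1 / \<bar>\<kappa>\<bar>)"
  proof (intro equalityI subsetI)
    fix p assume "p \<in> range (\<gamma> t)"
    then show "p \<in> sphere c (1 / \<bar>\<kappa>\<bar>)"
      using c norm_tangent[OF \<gamma>] by (auto simp: dist_norm normal_def norm_rot90)
  next
    fix p assume "p \<in> sphere c (1 / \<bar>\<kappa>\<bar>)"
    \<comment> \<open>Solving \<gamma> = c - \<nu>/\<kappa> for \<nu> at the point \<open>p\<close>
      gives the normal to be attained; it is a unit vector because the radius is
      1/|\<kappa>|.\<close>
    then have "norm (\<kappa> *\<^sub>R (c - p)) = 1" using \<kappa>0 by (simp add: dist_norm)
    then obtain u where "normal (\<gamma> t) u = \<kappa> *\<^sub>R (c - p)"
      using constant_curvature_normal_surj[OF \<gamma> \<kappa> \<kappa>0] by blast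
    then have "\<gamma> t u = p" using c[of u] \<kappa>0 by simp
    then show "p \<in> range (\<gamma> t)" by blast
  qed
  moreover have "\<bar>turning_number (\<gamma> t)\<bar> * (2 * pi * (1 / \<bar>\<kappa>\<bar>)) = L0"
    using tn_eq \<kappa>0 curve_length_pos[OF \<gamma>] assms(3) by (simp add: abs_mult)
  ultimately show ?thesis using \<kappa>0 by (metis zero_less_abs_iff zero_less_divide_1_iff)
qed

end
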